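(* Fix $1<p<\infty$, let $p'=p/(p-1)$, and let $\mathcal L:\mathbb B\to L^p_\#(\Omega)$ be a densely defined linear operator with closed range in $L^p_\#(\Omega)=L^p(\Omega)\cap\mathrm{Ker}(\mathcal P)$. Assume that there is a constant $\beta>0$ such that the a priori estimate $$\|g-\mathcal P^*g\|_{L^{p'}(\Omega)}\le \beta\,\|\mathcal L^*g\|_{\mathbb B^*}\qquad\text{for all } g\in L^{p'}(\Omega)$$ holds. Then there exists a constant $\gamma<\infty$, depending on $p$ and linearly on $\beta$, such that for any given $f\in L^p_\#(\Omega)$ the equation $\mathcal L U=f$ admits a hierarchical solution of the form $U=\sum_{j=1}^\infty \mathbf u_j\in\mathbb B$ with $$\|U\|_{\mathbb B}\le\gamma\,\|f\|_{L^p}.$$ Here the $\mathbf u_j$ are constructed recursively as minimizers $$\mathbf u_{j+1}=\mathop{\mathrm{arg\,min}}_{\mathbf u}\Big\{\|\mathbf u\|_{\mathbb B}+\lambda_{j+1}\Big\|f-\mathcal L\Big(\sum_{k=1}^{j}\mathbf u_k+\mathbf u\Big)\Big\|_{L^p}^p\Big\},\qquad j=0,1,2,\dots,$$ where $\{\lambda_j\}_{j\ge1}$ is the dyadic sequence $\lambda_{j+1}:=\lambda_1 2^{j}$ for a suitable, sufficiently large $\lambda_1>\frac{\beta}{p}\|f\|_{L^p}^{1-p}$ (for $f=0$ the condition on $\lambda_1$ is read as $\lambda_1>0$).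
   Context: $\Omega\subset\mathbb R^d$; $\mathbb B$ is a Banach space with norm $\|\cdot\|_{\mathbb B}$ and dual space $\mathbb B^*$. $\mathcal P:L^p(\Omega)\to L^p(\Omega)$ is a linear operator with dual $\mathcal P^*$ acting on $L^{p'}(\Omega)$, and $L^p_\#(\Omega):=L^p(\Omega)\cap\mathrm{Ker}(\mathcal P)$. $\mathcal L^*$ is the formal dual of $\mathcal L$, defined by $\langle\mathcal L^*g,\mathbf u\rangle=(g,\mathcal L\mathbf u)=\int_\Omega g\,\mathcal L\mathbf u\,dx$ for $g\in L^{p'}(\Omega)$ and $\mathbf u\in\mathbb B$ in the domain of $\mathcal L$, and the dual norm is $\|\mathcal L^*g\|_{\mathbb B^*}:=\sup_{\mathbf u\ne0}\langle\mathcal L^*g,\mathbf u\rangle/\|\mathbf u\|_{\mathbb B}$ (possibly $+\infty$). An empty sum $\sum_{k=1}^0$ is $0$.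
   Formalization: The operator L is additionally assumed closed, and the penalized minimization problems for the given f are assumed to have minimizers (for every base point in the domain and every positive weight); the claim fails without these. The constant may formally depend on d and B. *)

theory Defs
  imports "HOL-Analysis.Analysis"
begin

text \<open>
  Elements of $L^p(M)$ are represented by functions; equality in $L^p(M)$ is equality almost
  everywhere.  Accordingly, operators into $L^p(M)$ return representatives, and their linearity
  is required up to null sets.
\<close>

definition Lp_space :: "real \<Rightarrow> 'a measure \<Rightarrow> ('a \<Rightarrow> real) set" where
  "Lp_space p M = {f \<in> borel_measurable M. integrable M (\<lambda>x. \<bar>f x\<bar> powr p)}"

definition Lp_norm :: "real \<Rightarrow> 'a measure \<Rightarrow> ('a \<Rightarrow> real) \<Rightarrow> real" where
  "Lp_norm p M f = (\<integral>x. \<bar>f x\<bar> powr p \<partial>M) powr (1 / p)"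

definition conj_exponent :: "real \<Rightarrow> real" where
  "conj_exponent p = p / (p - 1)"

definition linear_operator_Lp ::
    "real \<Rightarrow> 'a measure \<Rightarrow> (('a \<Rightarrow> real) \<Rightarrow> ('a \<Rightarrow> real)) \<Rightarrow> bool" where
  "linear_operator_Lp p M P \<longleftrightarrow>
     (\<forall>f\<in>Lp_space p M. P f \<in> Lp_space p M) \<and>
     (\<forall>f\<in>Lp_space p M. \<forall>g\<in>Lp_space p M.
        (AE x in M. f x = g x) \<longrightarrow> (AE x in M. P f x = P g x)) \<and>
     (\<forall>f\<in>Lp_space p M. \<forall>g\<in>Lp_space p M. AE x in M. P (\<lambda>y. f y + g y) x = P f x + P g x) \<and>
     (\<forall>c. \<forall>f\<in>Lp_space p M. AE x in M. P (\<lambda>y. c * f y) x = c * P f x)"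

text \<open>
  The duality relation determines \<open>Q g\<close> up to null sets, so linearity of \<open>Q\<close> and its
  compatibility with a.e. equality need not be required separately.
\<close>

definition dual_operator_Lp ::
    "real \<Rightarrow> 'a measure \<Rightarrow> (('a \<Rightarrow> real) \<Rightarrow> ('a \<Rightarrow> real)) \<Rightarrow>
     (('a \<Rightarrow> real) \<Rightarrow> ('a \<Rightarrow> real)) \<Rightarrow> bool" where
  "dual_operator_Lp p M P Q \<longleftrightarrow>
     (\<forall>g\<in>Lp_space (conj_exponent p) M. Q g \<in> Lp_space (conj_exponent p) M) \<and>
     (\<forall>g\<in>Lp_space (conj_exponent p) M. \<forall>f\<in>Lp_space p M.
        (\<integral>x. Q g x * f x \<partial>M) = (\<integral>x. g x * P f x \<partial>M))"

definition Lp_sharp ::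
    "real \<Rightarrow> 'a measure \<Rightarrow> (('a \<Rightarrow> real) \<Rightarrow> ('a \<Rightarrow> real)) \<Rightarrow> ('a \<Rightarrow> real) set" where
  "Lp_sharp p M P = {f \<in> Lp_space p M. AE x in M. P f x = 0}"

text \<open>
  An unbounded operator is a total function \<open>L\<close> together with its domain \<open>D\<close>; the values
  of \<open>L\<close> outside \<open>D\<close> are irrelevant.
\<close>

definition densely_defined_operator ::
    "real \<Rightarrow> 'a measure \<Rightarrow> (('a \<Rightarrow> real) \<Rightarrow> ('a \<Rightarrow> real)) \<Rightarrow>
     'b::banach set \<Rightarrow> ('b \<Rightarrow> 'a \<Rightarrow> real) \<Rightarrow> bool" where
  "densely_defined_operator p M P D L \<longleftrightarrow>
     subspace D \<and> closure D = UNIV \<and>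
     (\<forall>u\<in>D. L u \<in> Lp_sharp p M P) \<and>
     (\<forall>u\<in>D. \<forall>v\<in>D. AE x in M. L (u + v) x = L u x + L v x) \<and>
     (\<forall>c. \<forall>u\<in>D. AE x in M. L (c *\<^sub>R u) x = c * L u x)"

definition closed_operator ::
    "real \<Rightarrow> 'a measure \<Rightarrow> 'b::banach set \<Rightarrow> ('b \<Rightarrow> 'a \<Rightarrow> real) \<Rightarrow> bool" where
  "closed_operator p M D L \<longleftrightarrow>
     (\<forall>u v h. (\<forall>n. u n \<in> D) \<and> u \<longlonglongrightarrow> v \<and> h \<in> Lp_space p M \<and>
        (\<lambda>n. Lp_norm p M (\<lambda>x. L (u n) x - h x)) \<longlonglongrightarrow> 0 \<longrightarrow>
        v \<in> D \<and> (AE x in M. L v x = h x))"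

definition closed_range ::
    "real \<Rightarrow> 'a measure \<Rightarrow> (('a \<Rightarrow> real) \<Rightarrow> ('a \<Rightarrow> real)) \<Rightarrow>
     'b::banach set \<Rightarrow> ('b \<Rightarrow> 'a \<Rightarrow> real) \<Rightarrow> bool" where
  "closed_range p M P D L \<longleftrightarrow>
     (\<forall>u h. (\<forall>n. u n \<in> D) \<and> h \<in> Lp_sharp p M P \<and>
        (\<lambda>n. Lp_norm p M (\<lambda>x. L (u n) x - h x)) \<longlonglongrightarrow> 0 \<longrightarrow>
        (\<exists>v\<in>D. AE x in M. L v x = h x))"

definition formal_dual ::
    "'a measure \<Rightarrow> ('b \<Rightarrow> 'a \<Rightarrow> real) \<Rightarrow> ('a \<Rightarrow> real) \<Rightarrow> 'b \<Rightarrow> real" where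
  "formal_dual M L g u = (\<integral>x. g x * L u x \<partial>M)"

text \<open>
  For a linear functional \<open>\<phi>\<close> on \<open>D\<close> the supremum is unchanged by the truncation of negative
  quotients implicit in \<^const>\<open>ennreal\<close>, since \<open>D\<close> is symmetric; if \<open>D = {0}\<close> its value is 0.
\<close>

definition dual_norm :: "'b::real_normed_vector set \<Rightarrow> ('b \<Rightarrow> real) \<Rightarrow> ennreal" where
  "dual_norm D \<phi> = (SUP u\<in>D - {0}. ennreal (\<phi> u / norm u))"

definition a_priori_estimate ::
    "real \<Rightarrow> 'a measure \<Rightarrow> (('a \<Rightarrow> real) \<Rightarrow> ('a \<Rightarrow> real)) \<Rightarrow>
     'b::banach set \<Rightarrow> ('b \<Rightarrow> 'a \<Rightarrow> real) \<Rightarrow> real \<Rightarrow> bool" where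
  "a_priori_estimate p M Q D L \<beta> \<longleftrightarrow>
     (\<forall>g\<in>Lp_space (conj_exponent p) M.
        ennreal (Lp_norm (conj_exponent p) M (\<lambda>x. g x - Q g x))
          \<le> ennreal \<beta> * dual_norm D (formal_dual M L g))"

definition penalty_functional ::
    "real \<Rightarrow> 'a measure \<Rightarrow> ('b::banach \<Rightarrow> 'a \<Rightarrow> real) \<Rightarrow> ('a \<Rightarrow> real) \<Rightarrow>
     real \<Rightarrow> 'b \<Rightarrow> 'b \<Rightarrow> real" where
  "penalty_functional p M L f \<mu> w v =
     norm v + \<mu> * Lp_norm p M (\<lambda>x. f x - L (w + v) x) powr p"

text \<open>
  Solvability of the minimization problems that occur in the hierarchical construction.  In a
  general Banach space it does not follow from closedness of \<open>L\<close>: a norm need not be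
  attained on a closed hyperplane.
\<close>

definition minimizers_exist ::
    "real \<Rightarrow> 'a measure \<Rightarrow> 'b::banach set \<Rightarrow> ('b \<Rightarrow> 'a \<Rightarrow> real) \<Rightarrow> ('a \<Rightarrow> real) \<Rightarrow> bool" where
  "minimizers_exist p M D L f \<longleftrightarrow>
     (\<forall>w\<in>D. \<forall>\<mu>>0. \<exists>v. is_arg_min (penalty_functional p M L f \<mu> w) (\<lambda>v. v \<in> D) v)"

text \<open>The sequence is indexed from 1; the value \<open>u 0\<close> is irrelevant.\<close>

definition hierarchical_minimizers ::
    "real \<Rightarrow> 'a measure \<Rightarrow> 'b::banach set \<Rightarrow> ('b \<Rightarrow> 'a \<Rightarrow> real) \<Rightarrow> ('a \<Rightarrow> real) \<Rightarrow>
     (nat \<Rightarrow> real) \<Rightarrow> (nat \<Rightarrow> 'b) \<Rightarrow> bool" where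
  "hierarchical_minimizers p M D L f \<mu> u \<longleftrightarrow>
     (\<forall>j. is_arg_min (penalty_functional p M L f (\<mu> (Suc j)) (\<Sum>k=1..j. u k))
            (\<lambda>v. v \<in> D) (u (Suc j)))"

end

theory Submission
  imports Defs
begin

text \<open>
  Let \<open>r\<close> be the residual after one minimization step with weight \<open>\<mu>\<close>. Minimality gives
  \<open>p \<mu> (g, L h) \<le> \<parallel>h\<parallel>\<close> for \<open>g = sgn r \<bar>r\<bar> powr (p - 1)\<close> and all \<open>h\<close> in the domain, so the a
  priori estimate bounds \<open>g - Q g\<close> in the dual exponent's norm by \<open>\<beta> / (p \<mu>)\<close>. As \<open>P r = 0\<close>,
  pairing with \<open>r\<close> yields \<open>\<parallel>r\<parallel> powr (p - 1) \<le> \<beta> / (p \<mu>)\<close>. If \<open>f \<noteq> 0\<close>, with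
  \<open>\<lambda>\<^sub>1 = 2 (\<beta> / p) \<parallel>f\<parallel> powr (1 - p)\<close> and dyadic weights the residuals decay like \<open>q ^ j \<parallel>f\<parallel>\<close>,
  \<open>q = 2 powr (- 1 / (p - 1))\<close>. Comparing each minimizer with \<open>0\<close> gives
  \<open>\<parallel>u (j + 1)\<parallel> \<le> (2 \<beta> / p) q ^ j \<parallel>f\<parallel>\<close>, a summable bound, and closedness of \<open>L\<close> identifies the
  sum as a solution.
\<close>

section \<open>Lp spaces of functions, with the inequalities of Young and Hoelder\<close>

lemma conj_exponent_gt_1: "1 < p \<Longrightarrow> 1 < conj_exponent p"
  by (simp add: conj_exponent_def field_simps)

lemma conj_exponent_inverse_sum: "1 < p \<Longrightarrow> 1 / p + 1 / conj_exponent p = 1"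
  by (simp add: conj_exponent_def field_simps)

lemma Lp_spaceD:
  assumes "f \<in> Lp_space p M"
  shows "f \<in> borel_measurable M" "integrable M (\<lambda>x. \<bar>f x\<bar> powr p)"
  using assms by (auto simp: Lp_space_def)

lemma Lp_norm_nonneg: "0 \<le> Lp_norm p M f"
  by (simp add: Lp_norm_def)

lemma Lp_norm_powr:
  assumes "0 < p"
  shows "Lp_norm p M f powr p = (\<integral>x. \<bar>f x\<bar> powr p \<partial>M)"
  using assms by (simp add: Lp_norm_def powr_powr)

lemma Lp_norm_cong_AE:
  assumes "f \<in> borel_measurable M" "g \<in> borel_measurable M" "AE x in M. f x = g x"
  shows "Lp_norm p M f = Lp_norm p M g"
proof -
  have "(\<integral>x. \<bar>f x\<bar> powr p \<partial>M) = (\<integral>x. \<bar>g x\<bar> powr p \<partial>M)"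
    using assms by (intro integral_cong_AE) auto
  then show ?thesis by (simp add: Lp_norm_def)
qed

text \<open>The sum is at most twice the maximum, and the \<open>p\<close>-th power of the maximum
  is one of the two summands. This works for every \<open>p > 0\<close>, with no appeal to
  convexity.\<close>

lemma powr_add_le:
  fixes a b p :: real
  assumes "0 \<le> a" "0 \<le> b" "0 < p"
  shows "(a + b) powr p \<le> 2 powr p * (a powr p + b powr p)"
proof -
  have "(a + b) powr p \<le> (2 * max a b) powr p"
    using assms by (intro powr_mono2) auto
  also have "\<dots> = 2 powr p * max a b powr p"
    using assms by (simp add: powr_mult)
  also have "\<dots> \<le> 2 powr p * (a powr p + b powr p)"
    by (intro mult_left_mono) (auto simp: max_def)
  finally show ?thesis .
qed

text \<open>Besides giving closure of \<open>Lp_space\<close> under addition, this function is the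
  majorant for the dominated convergence argument in
  \<open>Lp_directional_derivative_le\<close>.\<close>

lemma integrable_powr_add_abs:
  fixes f g :: "'a \<Rightarrow> real"
  assumes "0 < p" "f \<in> Lp_space p M" "g \<in> Lp_space p M"
  shows "integrable M (\<lambda>x. (\<bar>f x\<bar> + \<bar>g x\<bar>) powr p)"
proof (rule Bochner_Integration.integrable_bound)
  show "integrable M (\<lambda>x. 2 powr p * (\<bar>f x\<bar> powr p + \<bar>g x\<bar> powr p))"
    using assms by (auto dest: Lp_spaceD)
  have [measurable]: "f \<in> borel_measurable M" "g \<in> borel_measurable M"
    using assms by (auto dest: Lp_spaceD)
  show "(\<lambda>x. (\<bar>f x\<bar> + \<bar>g x\<bar>) powr p) \<in> borel_measurable M"
    by measurable
  show "AE x in M. norm ((\<bar>f x\<bar> + \<bar>g x\<bar>) powr p)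
      \<le> norm (2 powr p * (\<bar>f x\<bar> powr p + \<bar>g x\<bar> powr p))"
    using powr_add_le[OF abs_ge_zero abs_ge_zero assms(1)] by simp
qed

lemma Lp_space_add:
  assumes "0 < p" "f \<in> Lp_space p M" "g \<in> Lp_space p M"
  shows "(\<lambda>x. f x + g x) \<in> Lp_space p M"
proof -
  have [measurable]: "f \<in> borel_measurable M" "g \<in> borel_measurable M"
    using assms by (auto dest: Lp_spaceD)
  have "integrable M (\<lambda>x. \<bar>f x + g x\<bar> powr p)"
    by (rule Bochner_Integration.integrable_bound[OF integrable_powr_add_abs[OF assms]])
      (auto intro!: powr_mono2 less_imp_le[OF assms(1)])
  then show ?thesis by (simp add: Lp_space_def)
qed

lemma Lp_space_cmult:
  assumes "f \<in> Lp_space p M"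
  shows "(\<lambda>x. c * f x) \<in> Lp_space p M"
  using assms by (auto simp: Lp_space_def abs_mult powr_mult)

lemma Lp_space_diff:
  assumes "0 < p" "f \<in> Lp_space p M" "g \<in> Lp_space p M"
  shows "(\<lambda>x. f x - g x) \<in> Lp_space p M"
  using Lp_space_add[OF assms(1,2) Lp_space_cmult[OF assms(3), of "-1"]] by simp

lemma Youngs_inequality_abs:
  assumes "1 < p"
  shows "\<bar>a * b\<bar> \<le> \<bar>a\<bar> powr p / p + \<bar>b\<bar> powr conj_exponent p / conj_exponent p"
  using Youngs_inequality[OF assms conj_exponent_gt_1[OF assms] conj_exponent_inverse_sum[OF assms],
      of "\<bar>a\<bar>" "\<bar>b\<bar>"]
  by (simp add: abs_mult)

lemma integrable_mult_Lp:
  assumes "1 < p" "f \<in> Lp_space p M" "g \<in> Lp_space (conj_exponent p) M"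
  shows "integrable M (\<lambda>x. f x * g x)"
proof (rule Bochner_Integration.integrable_bound)
  show "integrable M (\<lambda>x. \<bar>f x\<bar> powr p / p + \<bar>g x\<bar> powr conj_exponent p / conj_exponent p)"
    using assms
    by (intro Bochner_Integration.integrable_add Bochner_Integration.integrable_divide Lp_spaceD)
  show "(\<lambda>x. f x * g x) \<in> borel_measurable M"
    using assms by (intro borel_measurable_times Lp_spaceD)
  show "AE x in M. norm (f x * g x)
      \<le> norm (\<bar>f x\<bar> powr p / p + \<bar>g x\<bar> powr conj_exponent p / conj_exponent p)"
  proof (rule AE_I2)
    fix x
    show "norm (f x * g x)
      \<le> norm (\<bar>f x\<bar> powr p / p + \<bar>g x\<bar> powr conj_exponent p / conj_exponent p)"
      using Youngs_inequality_abs[OF assms(1), of "f x" "g x"] by simp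
  qed
qed

lemma Lp_norm_eq_0_AE:
  assumes "0 < p" "f \<in> Lp_space p M" "Lp_norm p M f = 0"
  shows "AE x in M. f x = 0"
proof -
  have "(\<integral>x. \<bar>f x\<bar> powr p \<partial>M) = 0"
    using assms by (simp add: Lp_norm_def)
  then have "AE x in M. \<bar>f x\<bar> powr p = 0"
    using integral_nonneg_eq_0_iff_AE[OF Lp_spaceD(2)[OF assms(2)]] by simp
  then show ?thesis by simp
qed

text \<open>Young's inequality is integrated for the normalized functions \<open>f / F\<close> and
  \<open>g / G\<close>. If a norm vanishes, normalization is impossible, but then the product is
  zero almost everywhere.\<close>

lemma Holder_inequality_Lp:
  assumes "1 < p" "f \<in> Lp_space p M" "g \<in> Lp_space (conj_exponent p) M"
  shows "(\<integral>x. f x * g x \<partial>M) \<le> Lp_norm p M f * Lp_norm (conj_exponent p) M g"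
proof -
  define q where "q = conj_exponent p"
  have q: "1 < q" "1 / p + 1 / q = 1"
    using conj_exponent_gt_1[OF assms(1)] conj_exponent_inverse_sum[OF assms(1)]
    by (auto simp: q_def)
  define F G where "F = Lp_norm p M f" and "G = Lp_norm q M g"
  have FG: "0 \<le> F" "0 \<le> G"
    by (auto simp: F_def G_def Lp_norm_nonneg)
  have g: "g \<in> Lp_space q M" using assms by (simp add: q_def)
  show ?thesis
  proof (cases "F = 0 \<or> G = 0")
    case True
    then have "AE x in M. f x * g x = 0"
      using Lp_norm_eq_0_AE[of p f M] Lp_norm_eq_0_AE[of q g M] assms(1,2) q g
      by (auto simp: F_def G_def elim!: AE_mp)
    then have "(\<integral>x. f x * g x \<partial>M) = 0"
      by (rule integral_eq_zero_AE)
    then show ?thesis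
      using True by (auto simp: F_def G_def q_def)
  next
    case False
    then have pos: "0 < F" "0 < G" using FG by auto
    have "(\<integral>x. (f x / F) * (g x / G) \<partial>M)
        \<le> (\<integral>x. \<bar>f x\<bar> powr p / F powr p / p + \<bar>g x\<bar> powr q / G powr q / q \<partial>M)"
    proof (rule integral_mono)
      show "integrable M (\<lambda>x. (f x / F) * (g x / G))"
        using integrable_mult_Lp[OF assms] by simp
      show "integrable M (\<lambda>x. \<bar>f x\<bar> powr p / F powr p / p + \<bar>g x\<bar> powr q / G powr q / q)"
        using Lp_spaceD(2)[OF assms(2)] Lp_spaceD(2)[OF g] by auto
      fix x
      show "(f x / F) * (g x / G) \<le> \<bar>f x\<bar> powr p / F powr p / p + \<bar>g x\<bar> powr q / G powr q / q"
        using order_trans[OF abs_ge_self Youngs_inequality_abs[OF assms(1), of "f x / F" "g x / G"]] pos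
        by (simp add: q_def powr_divide)
    qed
    also have "\<dots> = (\<integral>x. \<bar>f x\<bar> powr p \<partial>M) / F powr p / p + (\<integral>x. \<bar>g x\<bar> powr q \<partial>M) / G powr q / q"
      using Lp_spaceD(2)[OF assms(2)] Lp_spaceD(2)[OF g] by simp
    also have "\<dots> = 1"
    proof -
      have "(\<integral>x. \<bar>f x\<bar> powr p \<partial>M) = F powr p" "(\<integral>x. \<bar>g x\<bar> powr q \<partial>M) = G powr q"
        using assms(1) q(1) by (simp_all add: F_def G_def Lp_norm_powr)
      then show ?thesis using pos q(2) by simp
    qed
    finally show ?thesis
      using pos by (simp add: F_def[symmetric] G_def[symmetric] q_def[symmetric] field_simps)
  qed
qed

section \<open>The derivative of the p-th power of the Lp norm\<close>

text \<open>For \<open>s = p - 1\<close> this is the derivative of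
  \<open>\<bar>x\<bar> powr p\<close> divided by \<open>p\<close>; applied pointwise it is, up to
  scaling, the duality map from Lp to its dual.\<close>

definition signed_powr :: "real \<Rightarrow> real \<Rightarrow> real" where
  "signed_powr s x = sgn x * \<bar>x\<bar> powr s"

lemma signed_powr_measurable [measurable]: "signed_powr s \<in> borel_measurable borel"
  unfolding signed_powr_def by measurable

lemma abs_signed_powr: "\<bar>signed_powr s x\<bar> = \<bar>x\<bar> powr s"
  by (cases "x = 0") (auto simp: signed_powr_def abs_mult abs_sgn_eq)

lemma signed_powr_mult_self: "signed_powr (p - 1) x * x = \<bar>x\<bar> powr p"
proof (cases "x = 0")
  case False
  have "signed_powr (p - 1) x * x = \<bar>x\<bar> powr (p - 1) * \<bar>x\<bar>"
    by (simp add: signed_powr_def abs_sgn)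
  also have "\<dots> = \<bar>x\<bar> powr p"
    using False by (simp add: powr_diff)
  finally show ?thesis .
qed simp

text \<open>The factor \<open>sgn\<close> jumps at 0, but there the absolute value
  \<open>\<bar>x\<bar> powr s\<close> tends to 0 because \<open>s > 0\<close>.\<close>

lemma isCont_signed_powr:
  assumes "0 < s"
  shows "isCont (signed_powr s) x"
proof (cases "x = 0")
  case True
  have "((\<lambda>y. \<bar>y\<bar> powr s) \<longlongrightarrow> \<bar>0::real\<bar> powr s) (at 0)"
    using assms by (intro tendsto_powr' tendsto_intros) auto
  then have "((\<lambda>y. \<bar>signed_powr s y\<bar>) \<longlongrightarrow> 0) (at 0)"
    by (simp add: abs_signed_powr)
  then have "(signed_powr s \<longlongrightarrow> 0) (at 0)"
    by (rule tendsto_rabs_zero_cancel)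
  then show ?thesis
    using True by (simp add: isCont_def signed_powr_def)
next
  case False
  then show ?thesis
    unfolding signed_powr_def by (intro continuous_intros) auto
qed

lemma signed_powr_Lp:
  assumes "1 < p" "f \<in> Lp_space p M"
  shows "(\<lambda>x. signed_powr (p - 1) (f x)) \<in> Lp_space (conj_exponent p) M"
proof -
  have [measurable]: "f \<in> borel_measurable M" using Lp_spaceD[OF assms(2)] by simp
  have "(p - 1) * conj_exponent p = p"
    using assms by (simp add: conj_exponent_def)
  then show ?thesis
    using Lp_spaceD[OF assms(2)] by (simp add: Lp_space_def abs_signed_powr powr_powr)
qed

text \<open>Young's inequality for \<open>a\<close> and \<open>signed_powr (p - 1) b\<close> is this subgradient inequality in disguise.\<close>

lemma abs_powr_subgradient:
  assumes "1 < p"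
  shows "\<bar>b\<bar> powr p + p * signed_powr (p - 1) b * (a - b) \<le> \<bar>a\<bar> powr p"
proof -
  have e: "(p - 1) * conj_exponent p = p"
    using assms by (simp add: conj_exponent_def)
  have "a * signed_powr (p - 1) b \<le> \<bar>a\<bar> powr p / p + \<bar>b\<bar> powr p / conj_exponent p"
    using Youngs_inequality_abs[OF assms, of a "signed_powr (p - 1) b"]
    by (simp add: abs_signed_powr powr_powr e)
  then have "p * (a * signed_powr (p - 1) b)
      \<le> p * (\<bar>a\<bar> powr p / p + \<bar>b\<bar> powr p / conj_exponent p)"
    using assms by (intro mult_left_mono) auto
  \<comment> \<open>This uses \<open>p / conj_exponent p = p - 1\<close>.\<close>
  also have "\<dots> = \<bar>a\<bar> powr p + (p - 1) * \<bar>b\<bar> powr p"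
    using assms by (simp add: conj_exponent_def field_simps)
  finally have "p * (a * signed_powr (p - 1) b) \<le> \<bar>a\<bar> powr p + (p - 1) * \<bar>b\<bar> powr p" .
  moreover have "p * signed_powr (p - 1) b * (a - b) = p * (a * signed_powr (p - 1) b) - p * \<bar>b\<bar> powr p"
    by (simp add: algebra_simps flip: signed_powr_mult_self)
  ultimately show ?thesis
    by (simp add: left_diff_distrib)
qed

text \<open>Convexity replaces differentiation under the integral. The subgradient inequality is
  taken at the shifted point \<open>r - t * k\<close>, since at \<open>r\<close> it would point the
  wrong way. Dividing by \<open>t\<close> bounds the derivative at the shifted point, and dominated
  convergence lets \<open>t\<close> tend to 0.\<close>

lemma Lp_directional_derivative_le:
  assumes p: "1 < p" and r: "r \<in> Lp_space p M" and k: "k \<in> Lp_space p M"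
    and le: "\<And>t. 0 < t \<Longrightarrow> (\<integral>x. \<bar>r x\<bar> powr p \<partial>M) \<le> (\<integral>x. \<bar>r x - t * k x\<bar> powr p \<partial>M) + t * c"
  shows "p * (\<integral>x. signed_powr (p - 1) (r x) * k x \<partial>M) \<le> c"
proof -
  have [measurable]: "r \<in> borel_measurable M" "k \<in> borel_measurable M"
    using r k by (auto dest: Lp_spaceD)
  \<comment> \<open>The step \<open>t = inverse (real (Suc n))\<close> never exceeds 1, so
    \<open>\<bar>b n x\<bar>\<close> is at most \<open>\<bar>r x\<bar> + \<bar>k x\<bar>\<close> for
    every \<open>n\<close>.\<close>
  define b where "b n x = r x - inverse (real (Suc n)) * k x" for n x
  have bLp: "b n \<in> Lp_space p M" for n
    unfolding b_def using p r k by (intro Lp_space_diff Lp_space_cmult) auto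
  have bounded: "p * (\<integral>x. signed_powr (p - 1) (b n x) * k x \<partial>M) \<le> c" for n
  proof -
    define t where "t = inverse (real (Suc n))"
    have t: "0 < t" by (simp add: t_def)
    have int: "integrable M (\<lambda>x. signed_powr (p - 1) (b n x) * k x)"
      using integrable_mult_Lp[OF p k signed_powr_Lp[OF p bLp[of n]]] by (simp add: mult.commute)
    have intb: "integrable M (\<lambda>x. \<bar>b n x\<bar> powr p)" using Lp_spaceD[OF bLp] by simp
    have "(\<integral>x. \<bar>b n x\<bar> powr p \<partial>M) + (t * p) * (\<integral>x. signed_powr (p - 1) (b n x) * k x \<partial>M)
        = (\<integral>x. \<bar>b n x\<bar> powr p + (t * p) * (signed_powr (p - 1) (b n x) * k x) \<partial>M)"
      using int intb by simp
    also have "\<dots> \<le> (\<integral>x. \<bar>r x\<bar> powr p \<partial>M)"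
    proof (rule integral_mono)
      show "integrable M (\<lambda>x. \<bar>b n x\<bar> powr p + (t * p) * (signed_powr (p - 1) (b n x) * k x))"
        using int intb by simp
      show "integrable M (\<lambda>x. \<bar>r x\<bar> powr p)" using Lp_spaceD[OF r] by simp
      fix x
      have "r x - b n x = t * k x" by (simp add: b_def t_def)
      then show "\<bar>b n x\<bar> powr p + (t * p) * (signed_powr (p - 1) (b n x) * k x) \<le> \<bar>r x\<bar> powr p"
        using abs_powr_subgradient[OF p, of "b n x" "r x"] by (simp add: mult_ac)
    qed
    also have "\<dots> \<le> (\<integral>x. \<bar>b n x\<bar> powr p \<partial>M) + t * c"
      using le[OF t] by (simp add: b_def t_def)
    finally have "t * (p * (\<integral>x. signed_powr (p - 1) (b n x) * k x \<partial>M)) \<le> t * c"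
      by (simp add: mult_ac)
    then show ?thesis using t by simp
  qed
  have "(\<lambda>n. \<integral>x. signed_powr (p - 1) (b n x) * k x \<partial>M)
      \<longlonglongrightarrow> (\<integral>x. signed_powr (p - 1) (r x) * k x \<partial>M)"
  proof (rule integral_dominated_convergence)
    show "integrable M (\<lambda>x. (\<bar>r x\<bar> + \<bar>k x\<bar>) powr p)"
      using p r k by (intro integrable_powr_add_abs) auto
    show "AE x in M. (\<lambda>n. signed_powr (p - 1) (b n x) * k x) \<longlonglongrightarrow> signed_powr (p - 1) (r x) * k x"
    proof (rule AE_I2)
      fix x
      have "(\<lambda>n. b n x) \<longlonglongrightarrow> r x - 0 * k x"
        unfolding b_def by (intro tendsto_intros LIMSEQ_inverse_real_of_nat)
      then have "(\<lambda>n. b n x) \<longlonglongrightarrow> r x" by simp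
      then show "(\<lambda>n. signed_powr (p - 1) (b n x) * k x) \<longlonglongrightarrow> signed_powr (p - 1) (r x) * k x"
        using p by (intro tendsto_mult isCont_tendsto_compose[OF isCont_signed_powr] tendsto_const) auto
    qed
    fix n
    show "AE x in M. norm (signed_powr (p - 1) (b n x) * k x) \<le> (\<bar>r x\<bar> + \<bar>k x\<bar>) powr p"
    proof (rule AE_I2)
      fix x
      have "\<bar>inverse (real (Suc n)) * k x\<bar> \<le> 1 * \<bar>k x\<bar>"
        unfolding abs_mult by (intro mult_right_mono) (auto simp: field_simps)
      then have b: "\<bar>b n x\<bar> \<le> \<bar>r x\<bar> + \<bar>k x\<bar>" unfolding b_def by linarith
      have "norm (signed_powr (p - 1) (b n x) * k x) = \<bar>b n x\<bar> powr (p - 1) * \<bar>k x\<bar>"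
        by (simp add: abs_mult abs_signed_powr)
      \<comment> \<open>Both factors are enlarged to the same base, so that the product is a single
        \<open>p\<close>-th power.\<close>
      also have "\<dots> \<le> (\<bar>r x\<bar> + \<bar>k x\<bar>) powr (p - 1) * (\<bar>r x\<bar> + \<bar>k x\<bar>)"
        using p b by (intro mult_mono powr_mono2) auto
      also have "\<dots> = (\<bar>r x\<bar> + \<bar>k x\<bar>) powr p"
        using signed_powr_mult_self[of p "\<bar>r x\<bar> + \<bar>k x\<bar>"]
        by (cases "\<bar>r x\<bar> + \<bar>k x\<bar> = 0") (auto simp: powr_diff)
      finally show "norm (signed_powr (p - 1) (b n x) * k x) \<le> (\<bar>r x\<bar> + \<bar>k x\<bar>) powr p" .
    qed
  qed (auto simp: b_def)
  then have "(\<lambda>n. p * (\<integral>x. signed_powr (p - 1) (b n x) * k x \<partial>M))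
      \<longlonglongrightarrow> p * (\<integral>x. signed_powr (p - 1) (r x) * k x \<partial>M)"
    by (intro tendsto_intros)
  then show ?thesis
    using bounded by (intro LIMSEQ_le_const2) auto
qed

section \<open>A single penalized minimization step\<close>

text \<open>The minimizer is compared with \<open>v + t *\<^sub>R h\<close> for
  \<open>t > 0\<close>. The norm of the Banach space may fail to be differentiable, so the triangle
  inequality bounds its growth by \<open>t * norm h\<close>; only the penalty term is
  differentiated.\<close>

lemma penalty_minimizer_first_order:
  assumes p: "1 < p" and L: "densely_defined_operator p M P D L"
    and f: "f \<in> Lp_space p M" and w: "w \<in> D" and \<mu>: "0 < \<mu>"
    and min: "is_arg_min (penalty_functional p M L f \<mu> w) (\<lambda>v. v \<in> D) v"
    and h: "h \<in> D"
  shows "p * \<mu> * formal_dual M L (\<lambda>x. signed_powr (p - 1) (f x - L (w + v) x)) h \<le> norm h"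
proof -
  have D: "subspace D"
    and LD: "\<And>u. u \<in> D \<Longrightarrow> L u \<in> Lp_space p M"
    and Ladd: "\<And>u v. u \<in> D \<Longrightarrow> v \<in> D \<Longrightarrow> AE x in M. L (u + v) x = L u x + L v x"
    and Lscale: "\<And>c u. u \<in> D \<Longrightarrow> AE x in M. L (c *\<^sub>R u) x = c * L u x"
    using L by (auto simp: densely_defined_operator_def Lp_sharp_def)
  have v: "v \<in> D" using min by (simp add: is_arg_min_def)
  have wv: "w + v \<in> D" using D v w by (simp add: subspace_add)
  define r where "r x = f x - L (w + v) x" for x
  have r: "r \<in> Lp_space p M"
    unfolding r_def using p f LD[OF wv] by (intro Lp_space_diff) auto
  have "(\<integral>x. \<bar>r x\<bar> powr p \<partial>M) \<le> (\<integral>x. \<bar>r x - t * L h x\<bar> powr p \<partial>M) + t * (norm h / \<mu>)"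
    if t: "0 < t" for t
  proof -
    have th: "t *\<^sub>R h \<in> D" using D h by (simp add: subspace_scale)
    have vth: "v + t *\<^sub>R h \<in> D" using D v th by (simp add: subspace_add)
    have wvth: "w + (v + t *\<^sub>R h) \<in> D" using D w vth by (simp add: subspace_add)
    have [measurable]: "f \<in> borel_measurable M" "L (w + v) \<in> borel_measurable M"
      "L h \<in> borel_measurable M" "L (w + (v + t *\<^sub>R h)) \<in> borel_measurable M"
      using f LD[OF wv] LD[OF h] LD[OF wvth] by (auto dest: Lp_spaceD)
    have "AE x in M. L (w + (v + t *\<^sub>R h)) x = L (w + v) x + t * L h x"
      using Ladd[OF wv th] Lscale[OF h, of t] by eventually_elim (simp add: add.assoc)
    then have "Lp_norm p M (\<lambda>x. f x - L (w + (v + t *\<^sub>R h)) x) = Lp_norm p M (\<lambda>x. r x - t * L h x)"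
      unfolding r_def by (intro Lp_norm_cong_AE) (auto elim!: AE_mp)
    then have "penalty_functional p M L f \<mu> w (v + t *\<^sub>R h)
        = norm (v + t *\<^sub>R h) + \<mu> * (\<integral>x. \<bar>r x - t * L h x\<bar> powr p \<partial>M)"
      using p by (simp add: penalty_functional_def Lp_norm_powr)
    moreover have "penalty_functional p M L f \<mu> w v = norm v + \<mu> * (\<integral>x. \<bar>r x\<bar> powr p \<partial>M)"
      using p by (simp add: penalty_functional_def Lp_norm_powr r_def)
    moreover have "penalty_functional p M L f \<mu> w v \<le> penalty_functional p M L f \<mu> w (v + t *\<^sub>R h)"
      using min vth by (simp add: is_arg_min_linorder)
    moreover have "norm (v + t *\<^sub>R h) \<le> norm v + t * norm h"
      using norm_triangle_ineq[of v "t *\<^sub>R h"] t by simp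
    ultimately have "\<mu> * (\<integral>x. \<bar>r x\<bar> powr p \<partial>M) \<le> \<mu> * (\<integral>x. \<bar>r x - t * L h x\<bar> powr p \<partial>M) + t * norm h"
      by linarith
    also have "\<dots> = \<mu> * ((\<integral>x. \<bar>r x - t * L h x\<bar> powr p \<partial>M) + t * (norm h / \<mu>))"
      using \<mu> by (simp add: field_simps)
    finally show ?thesis using \<mu> by simp
  qed
  then have "p * (\<integral>x. signed_powr (p - 1) (r x) * L h x \<partial>M) \<le> norm h / \<mu>"
    using Lp_directional_derivative_le[OF p r LD[OF h]] by blast
  then show ?thesis
    using \<mu> by (simp add: formal_dual_def r_def field_simps)
qed

lemma Lp_sharp_diff:
  assumes p: "1 < p" and P: "linear_operator_Lp p M P"
    and f: "f \<in> Lp_sharp p M P" and g: "g \<in> Lp_sharp p M P"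
  shows "(\<lambda>x. f x - g x) \<in> Lp_sharp p M P"
proof -
  have fg: "f \<in> Lp_space p M" "g \<in> Lp_space p M" "AE x in M. P f x = 0" "AE x in M. P g x = 0"
    using f g by (auto simp: Lp_sharp_def)
  have g': "(\<lambda>x. - 1 * g x) \<in> Lp_space p M" using fg by (intro Lp_space_cmult)
  have add: "\<And>a b. a \<in> Lp_space p M \<Longrightarrow> b \<in> Lp_space p M \<Longrightarrow>
      AE x in M. P (\<lambda>y. a y + b y) x = P a x + P b x"
    and scale: "\<And>c a. a \<in> Lp_space p M \<Longrightarrow> AE x in M. P (\<lambda>y. c * a y) x = c * P a x"
    using P by (simp_all add: linear_operator_Lp_def)
  have "AE x in M. P (\<lambda>y. f y + - 1 * g y) x = P f x + P (\<lambda>y. - 1 * g y) x"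
    by (rule add[OF fg(1) g'])
  moreover have "AE x in M. P (\<lambda>y. - 1 * g y) x = - 1 * P g x"
    by (rule scale[OF fg(2)])
  ultimately have "AE x in M. P (\<lambda>y. f y + - 1 * g y) x = 0"
    using fg(3,4) by eventually_elim simp
  then show ?thesis
    using p fg by (auto simp: Lp_sharp_def intro: Lp_space_diff)
qed

text \<open>Residuals stay in the kernel of \<open>P\<close>, which is what makes their pairing with
  \<open>Q g\<close> vanish.\<close>

lemma Lp_sharp_residual:
  assumes "1 < p" "linear_operator_Lp p M P" "densely_defined_operator p M P D L"
    and "f \<in> Lp_sharp p M P" "w \<in> D"
  shows "(\<lambda>x. f x - L w x) \<in> Lp_sharp p M P"
  using assms by (intro Lp_sharp_diff) (auto simp: densely_defined_operator_def)

text \<open>The bound depends only on \<beta>, \<open>p\<close> and \<mu>, neither on the previous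
  sum \<open>w\<close> nor on the size of \<open>f\<close>. Doubling the weight therefore improves
  it by a fixed factor whatever happened before.\<close>

lemma penalty_minimizer_residual_bound:
  assumes p: "1 < p" and P: "linear_operator_Lp p M P" and PQ: "dual_operator_Lp p M P Q"
    and L: "densely_defined_operator p M P D L"
    and est: "a_priori_estimate p M Q D L \<beta>" and \<beta>: "0 < \<beta>"
    and f: "f \<in> Lp_sharp p M P" and w: "w \<in> D" and \<mu>: "0 < \<mu>"
    and min: "is_arg_min (penalty_functional p M L f \<mu> w) (\<lambda>v. v \<in> D) v"
  shows "Lp_norm p M (\<lambda>x. f x - L (w + v) x) powr (p - 1) \<le> \<beta> / (p * \<mu>)"
proof -
  define r where "r x = f x - L (w + v) x" for x
  define g where "g x = signed_powr (p - 1) (r x)" for x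
  have "w + v \<in> D"
    using L w min by (simp add: is_arg_min_def densely_defined_operator_def subspace_add)
  then have "r \<in> Lp_sharp p M P"
    unfolding r_def using Lp_sharp_residual[OF p P L f] by simp
  then have r: "r \<in> Lp_space p M" and Pr: "AE x in M. P r x = 0"
    by (auto simp: Lp_sharp_def)
  have g: "g \<in> Lp_space (conj_exponent p) M"
    unfolding g_def by (rule signed_powr_Lp[OF p r])
  have Qg: "Q g \<in> Lp_space (conj_exponent p) M"
    using PQ g by (simp add: dual_operator_Lp_def)
  have gQ: "(\<lambda>x. g x - Q g x) \<in> Lp_space (conj_exponent p) M"
    using conj_exponent_gt_1[OF p] g Qg by (intro Lp_space_diff) auto
  \<comment> \<open>The dual norm may be infinite for a general \<open>g\<close>; for this one the
    first-order condition bounds every quotient, so the a priori estimate has content.\<close>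
  have "dual_norm D (formal_dual M L g) \<le> ennreal (1 / (p * \<mu>))"
    unfolding dual_norm_def
  proof (rule SUP_least, rule ennreal_leI)
    fix h assume h: "h \<in> D - {0}"
    have "f \<in> Lp_space p M" using f by (simp add: Lp_sharp_def)
    from penalty_minimizer_first_order[OF p L this w \<mu> min, of h] h
    have "p * \<mu> * formal_dual M L g h \<le> norm h"
      by (simp add: g_def[abs_def] r_def)
    then show "formal_dual M L g h / norm h \<le> 1 / (p * \<mu>)"
      using h p \<mu> by (simp add: field_simps)
  qed
  then have "ennreal \<beta> * dual_norm D (formal_dual M L g) \<le> ennreal \<beta> * ennreal (1 / (p * \<mu>))"
    by (rule mult_left_mono) simp
  also have "\<dots> = ennreal (\<beta> / (p * \<mu>))"
    using \<beta> p \<mu> by (simp flip: ennreal_mult)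
  finally have "ennreal (Lp_norm (conj_exponent p) M (\<lambda>x. g x - Q g x)) \<le> ennreal (\<beta> / (p * \<mu>))"
    using est g unfolding a_priori_estimate_def by (meson order_trans)
  then have G: "Lp_norm (conj_exponent p) M (\<lambda>x. g x - Q g x) \<le> \<beta> / (p * \<mu>)"
    using \<beta> p \<mu> by simp
  define R where "R = Lp_norm p M r"
  have R: "0 \<le> R" by (simp add: R_def Lp_norm_nonneg)
  \<comment> \<open>Duality moves \<open>Q\<close> onto \<open>r\<close> as \<open>P\<close>, and
    \<open>P r\<close> is zero almost everywhere. Hence \<open>g\<close> may be replaced by
    \<open>g - Q g\<close> in the pairing with \<open>r\<close>.\<close>
  have "(\<integral>x. Q g x * r x \<partial>M) = (\<integral>x. g x * P r x \<partial>M)"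
    using PQ g r by (simp add: dual_operator_Lp_def)
  also have "\<dots> = 0"
    using Pr by (intro integral_eq_zero_AE) (auto elim!: AE_mp)
  finally have Q0: "(\<integral>x. Q g x * r x \<partial>M) = 0" .
  have "R powr p = (\<integral>x. g x * r x \<partial>M)"
    using p by (simp add: R_def Lp_norm_powr g_def signed_powr_mult_self)
  also have "\<dots> = (\<integral>x. r x * g x \<partial>M) - (\<integral>x. r x * Q g x \<partial>M)"
    using Q0 by (simp add: mult.commute)
  also have "\<dots> = (\<integral>x. r x * (g x - Q g x) \<partial>M)"
    using integrable_mult_Lp[OF p r g] integrable_mult_Lp[OF p r Qg]
    by (simp add: right_diff_distrib)
  also have "\<dots> \<le> R * (\<beta> / (p * \<mu>))"
    unfolding R_def using Holder_inequality_Lp[OF p r gQ] G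
    by (meson Lp_norm_nonneg mult_left_mono order_trans)
  finally have "R powr p \<le> R * (\<beta> / (p * \<mu>))" .
  \<comment> \<open>One factor \<open>R\<close> is cancelled; for \<open>R = 0\<close> the left side
    is 0 by the convention for \<open>0 powr (p - 1)\<close>.\<close>
  then have "R powr (p - 1) \<le> \<beta> / (p * \<mu>)"
    using R \<beta> p \<mu> by (cases "R = 0") (auto simp: powr_diff field_simps)
  then show ?thesis by (simp add: R_def r_def[abs_def])
qed

text \<open>The competitor is 0, whose functional value is the penalty of the old residual
  alone.\<close>

lemma penalty_minimizer_norm_bound:
  assumes L: "densely_defined_operator p M P D L" and p: "1 < p" and \<mu>: "0 < \<mu>"
    and min: "is_arg_min (penalty_functional p M L f \<mu> w) (\<lambda>v. v \<in> D) v"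
  shows "norm v \<le> \<mu> * Lp_norm p M (\<lambda>x. f x - L w x) powr p"
proof -
  have "0 \<in> D" using L by (simp add: densely_defined_operator_def subspace_0)
  then have "penalty_functional p M L f \<mu> w v \<le> penalty_functional p M L f \<mu> w 0"
    using min by (simp add: is_arg_min_linorder)
  moreover have "norm v \<le> penalty_functional p M L f \<mu> w v"
    using \<mu> by (simp add: penalty_functional_def)
  ultimately show ?thesis
    by (simp add: penalty_functional_def)
qed

section \<open>The hierarchical construction and its convergence\<close>

text \<open>Each problem sees the earlier terms only through their sum. So the recursion runs on the
  partial sums \<open>s\<close>, with a chosen minimizer as increment, and staying in
  \<open>D\<close> keeps every problem solvable.\<close>

lemma hierarchical_minimizers_exist:
  assumes D: "subspace D" and ex: "minimizers_exist p M D L f" and pos: "\<And>j. 0 < \<mu> (Suc j)"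
  shows "\<exists>u. hierarchical_minimizers p M D L f \<mu> u"
proof -
  define sel where "sel j w = (SOME v. is_arg_min (penalty_functional p M L f (\<mu> (Suc j)) w) (\<lambda>v. v \<in> D) v)"
    for j w
  have sel: "is_arg_min (penalty_functional p M L f (\<mu> (Suc j)) w) (\<lambda>v. v \<in> D) (sel j w)"
    if "w \<in> D" for j w
    unfolding sel_def by (rule someI_ex) (use ex pos that in \<open>simp add: minimizers_exist_def\<close>)
  define s where "s = rec_nat 0 (\<lambda>j w. w + sel j w)"
  have s_simps: "s 0 = 0" "s (Suc j) = s j + sel j (s j)" for j
    by (auto simp: s_def)
  have s: "s j \<in> D" for j
  proof (induction j)
    case (Suc j)
    then have "sel j (s j) \<in> D" using sel[of "s j" j] by (simp add: is_arg_min_def)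
    then show ?case using Suc D by (simp add: s_simps subspace_add)
  qed (simp add: s_simps D subspace_0)
  \<comment> \<open>The shift gives \<open>u (Suc j) = sel j (s j)\<close>; \<open>u 0\<close> just
    repeats \<open>u 1\<close> and lies outside all sums.\<close>
  define u where "u j = sel (j - 1) (s (j - 1))" for j
  have "(\<Sum>k=1..j. u k) = s j" for j
    by (induction j) (auto simp: s_simps u_def)
  then have "hierarchical_minimizers p M D L f \<mu> u"
    unfolding hierarchical_minimizers_def using sel[OF s] by (simp add: u_def)
  then show ?thesis by blast
qed

text \<open>The constant is explicit so that it can later be fixed from \<open>p\<close> alone,
  before the domain and the operators are chosen.\<close>

lemma hierarchical_solution:
  assumes p: "1 < p" and P: "linear_operator_Lp p M P" and PQ: "dual_operator_Lp p M P Q"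
    and L: "densely_defined_operator p M P D L" and cl: "closed_operator p M D L"
    and est: "a_priori_estimate p M Q D L \<beta>" and \<beta>: "0 < \<beta>"
    and f: "f \<in> Lp_sharp p M P" and ex: "minimizers_exist p M D L f"
  shows "\<exists>lam :: nat \<Rightarrow> real. \<exists>u U.
    lam 1 > 0 \<and> lam 1 > \<beta> / p * Lp_norm p M f powr (1 - p) \<and>
    (\<forall>j. lam (Suc j) = lam 1 * 2 ^ j) \<and>
    hierarchical_minimizers p M D L f lam u \<and>
    (\<lambda>j. u (Suc j)) sums U \<and> U \<in> D \<and> (AE x in M. L U x = f x) \<and>
    norm U \<le> 2 / (p * (1 - 2 powr (- 1 / (p - 1)))) * \<beta> * Lp_norm p M f"
proof -
  have D: "subspace D" and LD: "\<And>u. u \<in> D \<Longrightarrow> L u \<in> Lp_space p M"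
    using L by (auto simp: densely_defined_operator_def Lp_sharp_def)
  have fLp: "f \<in> Lp_space p M" using f by (simp add: Lp_sharp_def)
  define F where "F = Lp_norm p M f"
  have F: "0 \<le> F" by (simp add: F_def Lp_norm_nonneg)
  \<comment> \<open>This is the solution of \<open>q powr (p - 1) = 1 / 2\<close>: doubling the
    weight shrinks the residual bound by exactly the factor \<open>q\<close>.\<close>
  define q :: real where "q = 2 powr (- 1 / (p - 1))"
  have q0: "0 < q" by (simp add: q_def)
  have q1: "q < 1"
    using powr_less_mono[of "- 1 / (p - 1)" 0 2] p by (simp add: q_def)
  have qp: "q powr (p - 1) = 1 / 2"
  proof -
    have "- 1 / (p - 1) * (p - 1) = - 1" using p by simp
    then have "q powr (p - 1) = 2 powr - 1" unfolding q_def powr_powr by presburger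
    then show ?thesis by (simp add: powr_minus)
  qed
  \<comment> \<open>Twice the required threshold makes \<open>\<beta> / (p * lam (Suc i))\<close>
    equal to \<open>F powr (p - 1) / 2 ^ Suc i\<close>. For \<open>F = 0\<close> the threshold
    evaluates to 0, and 1 exceeds it.\<close>
  define l1 where "l1 = (if F = 0 then 1 else 2 * (\<beta> / p * F powr (1 - p)))"
  have l1: "0 < l1" using F \<beta> p by (simp add: l1_def)
  have l1': "\<beta> / p * F powr (1 - p) < l1"
  proof (cases "F = 0")
    case False
    then have "0 < \<beta> / p * F powr (1 - p)" using F \<beta> p by simp
    then show ?thesis using False by (simp add: l1_def)
  qed (simp add: l1_def)
  define lam :: "nat \<Rightarrow> real" where "lam j = l1 * 2 ^ (j - 1)" for j
  have lam1: "lam 1 = l1" and lam_Suc: "\<And>j. lam (Suc j) = l1 * 2 ^ j"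
    by (simp_all add: lam_def)
  have lam_pos: "0 < lam (Suc j)" for j using l1 by (simp add: lam_Suc)
  obtain u where u: "hierarchical_minimizers p M D L f lam u"
    using hierarchical_minimizers_exist[OF D ex, of lam] lam_pos by blast
  define s where "s j = (\<Sum>k=1..j. u k)" for j
  have min: "is_arg_min (penalty_functional p M L f (lam (Suc j)) (s j)) (\<lambda>v. v \<in> D) (u (Suc j))"
    for j using u by (simp add: hierarchical_minimizers_def s_def)
  have s_Suc: "s (Suc j) = s j + u (Suc j)" for j by (simp add: s_def)
  have s: "s j \<in> D" for j
    unfolding s_def
  proof (rule subspace_sum[OF D])
    fix k assume "k \<in> {1..j}"
    then show "u k \<in> D" using min[of "k - 1"] by (simp add: is_arg_min_def)
  qed
  define R where "R j = Lp_norm p M (\<lambda>x. f x - L (s j) x)" for j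
  have R_nonneg: "0 \<le> R j" for j by (simp add: R_def Lp_norm_nonneg)
  \<comment> \<open>\<open>L 0\<close> vanishes only almost everywhere, by homogeneity with the
    scalar 0.\<close>
  have R0: "R 0 = F"
  proof -
    have "0 \<in> D" using D by (rule subspace_0)
    moreover have "AE x in M. L (0 *\<^sub>R 0) x = 0 * L 0 x"
      using L \<open>0 \<in> D\<close> unfolding densely_defined_operator_def by blast
    moreover have "f \<in> borel_measurable M" "L 0 \<in> borel_measurable M"
      using fLp LD[OF \<open>0 \<in> D\<close>] by (auto dest: Lp_spaceD)
    ultimately show ?thesis
      unfolding R_def F_def s_def by (intro Lp_norm_cong_AE) (auto elim!: AE_mp)
  qed
  have step: "norm (u (Suc j)) \<le> lam (Suc j) * R j powr p" for j
    unfolding R_def by (rule penalty_minimizer_norm_bound[OF L p lam_pos min])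
  have geometric_powr: "(q ^ j * F) powr (p - 1) = F powr (p - 1) / 2 ^ j" for j
  proof -
    have "(q ^ j) powr (p - 1) = (q powr (p - 1)) ^ j"
      using q0 by (induction j) (simp_all add: powr_mult)
    then show ?thesis
      using q0 F by (simp add: powr_mult qp power_divide)
  qed
  have R_le: "R j \<le> q ^ j * F" for j
  proof (cases "F = 0")
    case True
    \<comment> \<open>A zero residual forces the next minimizer to be 0 by \<open>step\<close>, so
      the residual stays zero.\<close>
    have "R j = 0"
    proof (induction j)
      case (Suc j)
      then have "u (Suc j) = 0" using step[of j] by simp
      then show ?case using Suc by (simp add: R_def s_Suc)
    qed (simp add: R0 True)
    then show ?thesis using True by simp
  next
    case False
    then have Fpos: "0 < F" using F by simp
    show ?thesis
    proof (cases j)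
      case 0
      then show ?thesis by (simp add: R0)
    next
      case (Suc i)
      \<comment> \<open>Each residual is bounded directly through the weight of its own step,
        without induction on the earlier ones.\<close>
      have "R (Suc i) powr (p - 1) \<le> \<beta> / (p * lam (Suc i))"
        unfolding R_def s_Suc
        by (rule penalty_minimizer_residual_bound[OF p P PQ L est \<beta> f s lam_pos min])
      also have "\<dots> = (q ^ Suc i * F) powr (p - 1)"
        using Fpos p \<beta> unfolding geometric_powr lam_Suc
        by (simp add: l1_def powr_diff field_simps)
      finally have "R (Suc i) powr (p - 1) \<le> (q ^ Suc i * F) powr (p - 1)" .
      then have "R (Suc i) \<le> q ^ Suc i * F"
        using powr_less_mono2[of "p - 1" "q ^ Suc i * F" "R (Suc i)"] p q0 F by force
      then show ?thesis using Suc by simp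
    qed
  qed
  have u_le: "norm (u (Suc j)) \<le> 2 * \<beta> / p * F * q ^ j" for j
  proof (cases "F = 0")
    case True
    then have "R j = 0" using R_le[of j] R_nonneg[of j] by simp
    then show ?thesis using step[of j] True by simp
  next
    case False
    then have Fpos: "0 < F" using F by simp
    have "norm (u (Suc j)) \<le> lam (Suc j) * (q ^ j * F) powr p"
      using step[of j] R_le[of j] R_nonneg[of j] p lam_pos[of j]
      by (meson less_imp_le mult_left_mono order_trans powr_mono2 zero_less_one)
    \<comment> \<open>Splitting off \<open>p - 1\<close> powers produces
      \<open>F powr (p - 1) / 2 ^ j\<close>, which cancels the growth of the weight. The remaining
      factor \<open>q ^ j * F\<close> makes the series summable.\<close>
    also have "(q ^ j * F) powr p = (q ^ j * F) powr (p - 1) * (q ^ j * F)"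
      using Fpos q0 by (simp add: powr_diff)
    also have "lam (Suc j) * \<dots> = 2 * \<beta> / p * F * q ^ j"
      using Fpos False p unfolding geometric_powr lam_Suc
      by (simp add: l1_def powr_diff field_simps)
    finally show ?thesis .
  qed
  have geom: "(\<lambda>j. 2 * \<beta> / p * F * q ^ j) sums (2 * \<beta> / p * F * (1 / (1 - q)))"
    using q0 q1 by (intro sums_mult geometric_sums) simp
  have sm: "summable (\<lambda>j. norm (u (Suc j)))"
    using u_le by (intro summable_comparison_test'[OF sums_summable[OF geom]]) simp
  define U where "U = (\<Sum>j. u (Suc j))"
  have sums: "(\<lambda>j. u (Suc j)) sums U"
    unfolding U_def using summable_norm_cancel[OF sm] by (rule summable_sums)
  have "norm U \<le> (\<Sum>j. norm (u (Suc j)))"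
    unfolding U_def by (rule summable_norm[OF sm])
  also have "\<dots> \<le> 2 * \<beta> / p * F * (1 / (1 - q))"
    using u_le sums_summable[OF geom] sm geom
    by (metis sums_unique suminf_le)
  finally have U_le: "norm U \<le> 2 / (p * (1 - q)) * \<beta> * F"
    by (simp add: mult_ac)
  have "s \<longlonglongrightarrow> U"
    using sums unfolding sums_def s_def by (simp add: sum.atLeast1_atMost_eq)
  \<comment> \<open>The images of the partial sums converge to \<open>f\<close> because this
    distance is the residual norm; closedness of \<open>L\<close> then applies to the pair of limits
    \<open>U\<close> and \<open>f\<close>.\<close>
  moreover have "(\<lambda>n. Lp_norm p M (\<lambda>x. L (s n) x - f x)) \<longlonglongrightarrow> 0"
  proof (rule tendsto_sandwich[of "\<lambda>_. 0" _ _ "\<lambda>n. q ^ n * F"])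
    have "(\<lambda>n. q ^ n * F) \<longlonglongrightarrow> 0 * F"
      using q0 q1 by (intro tendsto_intros LIMSEQ_realpow_zero) auto
    then show "(\<lambda>n. q ^ n * F) \<longlonglongrightarrow> 0" by simp
    have "Lp_norm p M (\<lambda>x. L (s n) x - f x) = R n" for n
      by (simp add: R_def Lp_norm_def abs_minus_commute)
    then show "\<forall>\<^sub>F n in sequentially. Lp_norm p M (\<lambda>x. L (s n) x - f x) \<le> q ^ n * F"
      using R_le by simp
  qed (simp_all add: Lp_norm_nonneg)
  ultimately have "U \<in> D \<and> (AE x in M. L U x = f x)"
    using cl s fLp unfolding closed_operator_def by blast
  then show ?thesis
    using l1 l1' u sums U_le unfolding F_def q_def
    by (intro exI[of _ lam] exI[of _ u] exI[of _ U]) (simp add: lam1 lam_Suc flip: One_nat_def)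
qed

theorem theorem1p1:
  fixes p :: real
  assumes "1 < p"
  shows "\<exists>C>0. \<forall>(\<Omega> :: (real ^ 'n) set) P Q (D :: 'b::banach set) L \<beta>.
    \<Omega> \<in> sets lebesgue \<and>
    linear_operator_Lp p (lebesgue_on \<Omega>) P \<and>
    dual_operator_Lp p (lebesgue_on \<Omega>) P Q \<and>
    densely_defined_operator p (lebesgue_on \<Omega>) P D L \<and>
    closed_operator p (lebesgue_on \<Omega>) D L \<and>
    closed_range p (lebesgue_on \<Omega>) P D L \<and>
    \<beta> > 0 \<and>
    a_priori_estimate p (lebesgue_on \<Omega>) Q D L \<beta> \<longrightarrow>
    (\<exists>\<gamma>. \<gamma> = C * \<beta> \<and>
      (\<forall>f \<in> Lp_sharp p (lebesgue_on \<Omega>) P.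
        minimizers_exist p (lebesgue_on \<Omega>) D L f \<longrightarrow>
        (\<exists>lam :: nat \<Rightarrow> real. \<exists>u U.
          lam 1 > 0 \<and> lam 1 > \<beta> / p * Lp_norm p (lebesgue_on \<Omega>) f powr (1 - p) \<and>
          (\<forall>j. lam (Suc j) = lam 1 * 2 ^ j) \<and>
          hierarchical_minimizers p (lebesgue_on \<Omega>) D L f lam u \<and>
          (\<lambda>j. u (Suc j)) sums U \<and>
          U \<in> D \<and> (AE x in lebesgue_on \<Omega>. L U x = f x) \<and>
          norm U \<le> \<gamma> * Lp_norm p (lebesgue_on \<Omega>) f)))"
proof -
  let ?C = "2 / (p * (1 - 2 powr (- 1 / (p - 1)))) :: real"
  \<comment> \<open>The ratio of the geometric series is below 1, so the denominator of
    \<open>?C\<close> is positive.\<close>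
  have "(2::real) powr (- 1 / (p - 1)) < 2 powr 0"
    using assms by (intro powr_less_mono) auto
  then have pos: "0 < ?C" using assms by simp
  show ?thesis
  proof (rule exI[of _ ?C], intro conjI allI impI, rule pos)
    fix \<Omega> :: "(real ^ 'n) set" and P Q and D :: "'b set" and L \<beta>
    let ?M = "lebesgue_on \<Omega>"
    assume "\<Omega> \<in> sets lebesgue \<and> linear_operator_Lp p ?M P \<and> dual_operator_Lp p ?M P Q \<and>
      densely_defined_operator p ?M P D L \<and> closed_operator p ?M D L \<and>
      closed_range p ?M P D L \<and> \<beta> > 0 \<and> a_priori_estimate p ?M Q D L \<beta>"
    then show "\<exists>\<gamma>. \<gamma> = ?C * \<beta> \<and>
      (\<forall>f \<in> Lp_sharp p ?M P. minimizers_exist p ?M D L f \<longrightarrow>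
        (\<exists>lam :: nat \<Rightarrow> real. \<exists>u U.
          lam 1 > 0 \<and> lam 1 > \<beta> / p * Lp_norm p ?M f powr (1 - p) \<and>
          (\<forall>j. lam (Suc j) = lam 1 * 2 ^ j) \<and>
          hierarchical_minimizers p ?M D L f lam u \<and>
          (\<lambda>j. u (Suc j)) sums U \<and> U \<in> D \<and> (AE x in ?M. L U x = f x) \<and>
          norm U \<le> \<gamma> * Lp_norm p ?M f))"
      by (intro exI[of _ "?C * \<beta>"] conjI refl ballI impI hierarchical_solution[OF assms, where Q = Q])
        simp_all
  qed
qed

end
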